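(* Let $(G,M)$ be a square graph with squares $C_1,\dots,C_t$ and let $c\in\mathbb{R}^{E(G)}$. For each square $C$ let $w_C$ be the absolute value of the difference of the costs of the two perfect matchings of $C$, and order the squares so that $w_{C_1}\ge w_{C_2}\ge\dots\ge w_{C_t}$. Run the following procedure (HAM): starting from the graph $G$, for $i=1,\dots,t$ in turn, keep exactly one of the two perfect matchings of $C_i$ and delete both edges of the other from the current graph, where: if the current graph remains connected under both choices, keep the perfect matching of $C_i$ of smaller cost (ties broken arbitrarily); if it remains connected under exactly one of the two choices, make that choice. Then at each step at least one of the two choices keeps the graph connected, and the final graph is a Hamiltonian cycle of $G$ containing $M$ of minimum cost among all Hamiltonian cycles of $G$ containing $M$.
   Context: A square graph is a pair $(G,M)$ where $G=(V,E)$ is a cubic $2$-edge-connected graph and $M$ is a perfect matching of $G$ such that the edges of $E\setminus M$ form a node-disjoint union of $4$-cycles, called squares. Each square, being a $4$-cycle, has exactly two perfect matchings (pairs of opposite edges). The cost of an edge set is the sum of the costs of its edges. *)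

theory Defs
  imports Complex_Main
begin

text \<open>
  A graph has a set \<open>V\<close> of vertices, a set \<open>E\<close> of edges and a map \<open>ends\<close> that gives the set
  of the two ends of an edge. Parallel edges are allowed; a simple graph is the case where \<open>ends\<close>
  is injective on \<open>E\<close>, for example \<open>ends = id\<close> on a set of two-element sets. Loops are left out:
  in a cubic graph a loop forces a bridge. A spanning subgraph is given by its set of edges.
\<close>

definition finite_graph :: "'v set \<Rightarrow> 'e set \<Rightarrow> ('e \<Rightarrow> 'v set) \<Rightarrow> bool" where
  "finite_graph V E ends \<longleftrightarrow>
     finite V \<and> finite E \<and> (\<forall>e\<in>E. ends e \<subseteq> V \<and> card (ends e) = 2)"

definition graph_connected :: "'v set \<Rightarrow> ('e \<Rightarrow> 'v set) \<Rightarrow> 'e set \<Rightarrow> bool" where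
  "graph_connected V ends F \<longleftrightarrow>
     V \<noteq> {} \<and> (\<forall>u\<in>V. \<forall>v\<in>V. (\<lambda>x y. \<exists>e\<in>F. ends e = {x, y})\<^sup>*\<^sup>* u v)"

definition two_edge_connected :: "'v set \<Rightarrow> ('e \<Rightarrow> 'v set) \<Rightarrow> 'e set \<Rightarrow> bool" where
  "two_edge_connected V ends E \<longleftrightarrow>
     graph_connected V ends E \<and> (\<forall>e\<in>E. graph_connected V ends (E - {e}))"

definition cubic :: "'v set \<Rightarrow> ('e \<Rightarrow> 'v set) \<Rightarrow> 'e set \<Rightarrow> bool" where
  "cubic V ends E \<longleftrightarrow> (\<forall>v\<in>V. card {e \<in> E. v \<in> ends e} = 3)"

definition perfect_matching :: "'v set \<Rightarrow> ('e \<Rightarrow> 'v set) \<Rightarrow> 'e set \<Rightarrow> 'e set \<Rightarrow> bool" where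
  "perfect_matching V ends E P \<longleftrightarrow> P \<subseteq> E \<and> (\<forall>v\<in>V. \<exists>!e. e \<in> P \<and> v \<in> ends e)"

text \<open>
  \<open>cycle_on W ends F\<close>: the edges of \<open>F\<close> form one cycle with vertex set \<open>W\<close>. A cycle of length
  two consists of two parallel edges.
\<close>

definition cycle_on :: "'v set \<Rightarrow> ('e \<Rightarrow> 'v set) \<Rightarrow> 'e set \<Rightarrow> bool" where
  "cycle_on W ends F \<longleftrightarrow>
     (\<exists>vs es. distinct vs \<and> set vs = W \<and> distinct es \<and> set es = F \<and>
        length es = length vs \<and> 2 \<le> length vs \<and>
        (\<forall>i < length vs. ends (es ! i) = {vs ! i, vs ! (Suc i mod length vs)}))"

definition verts_of :: "('e \<Rightarrow> 'v set) \<Rightarrow> 'e set \<Rightarrow> 'v set" where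
  "verts_of ends F = (\<Union>e\<in>F. ends e)"

definition four_cycle :: "('e \<Rightarrow> 'v set) \<Rightarrow> 'e set \<Rightarrow> bool" where
  "four_cycle ends C \<longleftrightarrow> card C = 4 \<and> cycle_on (verts_of ends C) ends C"

definition square_decomposition :: "('e \<Rightarrow> 'v set) \<Rightarrow> 'e set \<Rightarrow> 'e set set \<Rightarrow> bool" where
  "square_decomposition ends F S \<longleftrightarrow>
     \<Union>S = F \<and> (\<forall>C\<in>S. four_cycle ends C) \<and>
     (\<forall>C\<in>S. \<forall>D\<in>S. C \<noteq> D \<longrightarrow> verts_of ends C \<inter> verts_of ends D = {})"

definition square_graph :: "'v set \<Rightarrow> 'e set \<Rightarrow> ('e \<Rightarrow> 'v set) \<Rightarrow> 'e set \<Rightarrow> bool" where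
  "square_graph V E ends M \<longleftrightarrow>
     finite_graph V E ends \<and> cubic V ends E \<and> two_edge_connected V ends E \<and>
     perfect_matching V ends E M \<and> (\<exists>S. square_decomposition ends (E - M) S)"

definition hamiltonian_cycle :: "'v set \<Rightarrow> 'e set \<Rightarrow> ('e \<Rightarrow> 'v set) \<Rightarrow> 'e set \<Rightarrow> bool" where
  "hamiltonian_cycle V E ends F \<longleftrightarrow> F \<subseteq> E \<and> cycle_on V ends F"

definition cost :: "('e \<Rightarrow> real) \<Rightarrow> 'e set \<Rightarrow> real" where
  "cost c F = (\<Sum>e\<in>F. c e)"

definition square_matchings :: "('e \<Rightarrow> 'v set) \<Rightarrow> 'e set \<Rightarrow> 'e set set" where
  "square_matchings ends C = {P. perfect_matching (verts_of ends C) ends C P}"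

definition square_weight :: "('e \<Rightarrow> 'v set) \<Rightarrow> ('e \<Rightarrow> real) \<Rightarrow> 'e set \<Rightarrow> real" where
  "square_weight ends c C =
     (THE w. \<exists>P Q. P \<noteq> Q \<and> square_matchings ends C = {P, Q} \<and> w = \<bar>cost c P - cost c Q\<bar>)"

text \<open>
  One step of HAM at the square \<open>C\<close>, from the current graph \<open>H\<close> to \<open>H'\<close>: \<open>P\<close> is the matching
  kept and \<open>Q\<close> the matching deleted. Nothing is prescribed if neither choice leaves the graph
  connected, so that a step exists in every case.
\<close>

definition ham_step ::
  "'v set \<Rightarrow> ('e \<Rightarrow> 'v set) \<Rightarrow> ('e \<Rightarrow> real) \<Rightarrow> 'e set \<Rightarrow> 'e set \<Rightarrow> 'e set \<Rightarrow> bool" where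
  "ham_step V ends c C H H' \<longleftrightarrow>
     (\<exists>P Q. P \<noteq> Q \<and> square_matchings ends C = {P, Q} \<and> H' = H - Q \<and>
        (graph_connected V ends (H - P) \<and> graph_connected V ends (H - Q) \<longrightarrow>
           cost c P \<le> cost c Q) \<and>
        (graph_connected V ends (H - P) \<noteq> graph_connected V ends (H - Q) \<longrightarrow>
           graph_connected V ends (H - Q)))"

text \<open>\<open>H i\<close> is the current graph after the first \<open>i\<close> squares of the list.\<close>

definition ham_run ::
  "'v set \<Rightarrow> 'e set \<Rightarrow> ('e \<Rightarrow> 'v set) \<Rightarrow> ('e \<Rightarrow> real) \<Rightarrow> 'e set list \<Rightarrow> (nat \<Rightarrow> 'e set) \<Rightarrow> bool" where
  "ham_run V E ends c Cs H \<longleftrightarrow>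
     H 0 = E \<and> (\<forall>i < length Cs. ham_step V ends c (Cs ! i) (H i) (H (Suc i)))"

lemma four_cycle_matchings:
  assumes "four_cycle ends C"
  obtains P Q where "P \<noteq> Q" "P \<union> Q = C" "P \<inter> Q = {}" "card P = 2" "card Q = 2"
    "square_matchings ends C = {P, Q}"
proof -
  obtain vs es where vs: "distinct vs" "set vs = verts_of ends C"
    and es: "distinct es" "set es = C" and len: "length es = length vs"
    and inc: "\<forall>i < length vs. ends (es ! i) = {vs ! i, vs ! (Suc i mod length vs)}"
    using assms unfolding four_cycle_def cycle_on_def by blast
  have "length es = 4"
    using assms es unfolding four_cycle_def by (metis distinct_card)
  then obtain e0 e1 e2 e3 where e: "es = [e0, e1, e2, e3]"
    by (auto simp: numeral_eq_Suc length_Suc_conv)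
  have "length vs = 4" using len \<open>length es = 4\<close> by simp
  then obtain a b x d where v: "vs = [a, b, x, d]"
    by (auto simp: numeral_eq_Suc length_Suc_conv)
  have ends: "ends e0 = {a, b}" "ends e1 = {b, x}" "ends e2 = {x, d}" "ends e3 = {d, a}"
    using inc[rule_format, of 0] inc[rule_format, of "Suc 0"] inc[rule_format, of "Suc (Suc 0)"]
      inc[rule_format, of "Suc (Suc (Suc 0))"] by (simp_all add: e v)
  have dv: "a \<noteq> b" "a \<noteq> x" "a \<noteq> d" "b \<noteq> x" "b \<noteq> d" "x \<noteq> d"
    using vs(1) v by auto
  have de: "e0 \<noteq> e1" "e0 \<noteq> e2" "e0 \<noteq> e3" "e1 \<noteq> e2" "e1 \<noteq> e3" "e2 \<noteq> e3"
    using es(1) e by auto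
  have C: "C = {e0, e1, e2, e3}" using es(2) e by auto
  have W: "verts_of ends C = {a, b, x, d}" using vs(2) v by auto
  have pm: "perfect_matching {a, b, x, d} ends C P \<longleftrightarrow> P = {e0, e2} \<or> P = {e1, e3}" for P
  proof
    assume P: "perfect_matching {a, b, x, d} ends C P"
    then have sub: "P \<subseteq> {e0, e1, e2, e3}" by (simp add: perfect_matching_def C)
    have one: "(f \<in> P) \<noteq> (g \<in> P)"
      if y: "y \<in> {a, b, x, d}" and fg: "f \<noteq> g" "\<And>e. e \<in> C \<Longrightarrow> y \<in> ends e \<longleftrightarrow> e = f \<or> e = g"
        and in_C: "f \<in> C" "g \<in> C" for y f g
    proof -
      obtain e where "e \<in> P" "y \<in> ends e" and uniq: "\<And>e'. e' \<in> P \<Longrightarrow> y \<in> ends e' \<Longrightarrow> e' = e"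
        using P y unfolding perfect_matching_def by blast
      moreover have "e = f \<or> e = g" using calculation sub C fg(2) by blast
      moreover have "y \<in> ends f" "y \<in> ends g" using fg(2) in_C by simp_all
      ultimately show ?thesis using fg(1) by blast
    qed
    have "(e0 \<in> P) \<noteq> (e3 \<in> P)"
      by (rule one[of a]) (use ends dv de C in auto)
    moreover have "(e0 \<in> P) \<noteq> (e1 \<in> P)"
      by (rule one[of b]) (use ends dv de C in auto)
    moreover have "(e1 \<in> P) \<noteq> (e2 \<in> P)"
      by (rule one[of x]) (use ends dv de C in auto)
    ultimately show "P = {e0, e2} \<or> P = {e1, e3}" using sub by blast
  next
    assume "P = {e0, e2} \<or> P = {e1, e3}"
    then show "perfect_matching {a, b, x, d} ends C P"
      using ends dv de by (auto simp: perfect_matching_def C)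
  qed
  show thesis
  proof (rule that[of "{e0, e2}" "{e1, e3}"])
    show "square_matchings ends C = {{e0, e2}, {e1, e3}}"
      unfolding square_matchings_def W pm by blast
  qed (use de C in auto)
qed

lemma square_weight_eq:
  assumes "P \<noteq> Q" "square_matchings ends C = {P, Q}"
  shows "square_weight ends c C = \<bar>cost c P - cost c Q\<bar>"
  unfolding square_weight_def
proof (rule the_equality)
  fix w
  assume "\<exists>P Q. P \<noteq> Q \<and> square_matchings ends C = {P, Q} \<and> w = \<bar>cost c P - cost c Q\<bar>"
  then obtain P' Q' where "{P, Q} = {P', Q'}" and w: "w = \<bar>cost c P' - cost c Q'\<bar>"
    unfolding assms(2) by (elim exE conjE)
  then have "P = P' \<and> Q = Q' \<or> P = Q' \<and> Q = P'" by (simp add: doubleton_eq_iff)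
  then show "w = \<bar>cost c P - cost c Q\<bar>"
    unfolding w by (elim disjE conjE) (simp_all add: abs_minus_commute)
qed (use assms in blast)

lemma ham_step_exists:
  assumes "four_cycle ends C"
  shows "\<exists>H'. ham_step V ends c C H H'"
proof -
  obtain P Q where PQ: "P \<noteq> Q" "square_matchings ends C = {P, Q}"
    using assms by (rule four_cycle_matchings)
  have QP: "square_matchings ends C = {Q, P}" using PQ(2) by blast
  let ?p = "graph_connected V ends (H - P)" and ?q = "graph_connected V ends (H - Q)"
  show ?thesis
  proof (cases "(?p \<and> ?q \<longrightarrow> cost c P \<le> cost c Q) \<and> (?p \<noteq> ?q \<longrightarrow> ?q)")
    case True
    show ?thesis
      unfolding ham_step_def
      by (rule exI[of _ "H - Q"], rule exI[of _ P], rule exI[of _ Q])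
        (intro conjI refl PQ True[THEN conjunct1] True[THEN conjunct2])
  next
    case False
    then have *: "(?q \<and> ?p \<longrightarrow> cost c Q \<le> cost c P) \<and> (?q \<noteq> ?p \<longrightarrow> ?p)" by linarith
    show ?thesis
      unfolding ham_step_def
      by (rule exI[of _ "H - P"], rule exI[of _ Q], rule exI[of _ P])
        (intro conjI refl PQ(1)[symmetric] QP *[THEN conjunct1] *[THEN conjunct2])
  qed
qed

end

theory Submission
  imports Defs
begin

text \<open>
  Hamiltonian cycles containing \<open>M\<close> are the connected graphs formed by \<open>M\<close> and one perfect
  matching of every square. Connectivity is handled through cuts: a graph is connected iff every
  proper nonempty vertex set is crossed by one of its edges. The number of edges of a perfect
  matching that cross \<open>W\<close> has the parity of \<open>card W\<close>, so a set not crossed by \<open>M\<close> is never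
  crossed by exactly one edge of another perfect matching. This shows that some choice at every
  step preserves connectivity, and that the Hamiltonian cycles containing \<open>M\<close>, as choices over
  the squares, satisfy the symmetric exchange axiom of delta-matroids. The exchange turns any
  competitor, at no extra cost, into one that agrees with the result of HAM on a longer initial
  segment of the squares: correcting square \<open>i\<close> gains \<open>w\<^sub>i\<close>, and the second square exchanged
  comes later in the order, so it costs at most \<open>w\<^sub>i\<close>.
\<close>

section \<open>Cuts and parity\<close>

text \<open>For \<open>W \<subseteq> V\<close> and edges inside \<open>V\<close> this makes
  \<open>W\<close> a union of components of the spanning subgraph \<open>F\<close>. In this form
  intersections and symmetric differences of such sets are again such sets.\<close>

definition uncrossed :: "('e \<Rightarrow> 'v set) \<Rightarrow> 'e set \<Rightarrow> 'v set \<Rightarrow> bool" where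
  "uncrossed ends F W \<longleftrightarrow> (\<forall>e\<in>F. ends e \<subseteq> W \<or> ends e \<inter> W = {})"

lemma uncrossed_Un: "uncrossed ends (F \<union> G) W \<longleftrightarrow> uncrossed ends F W \<and> uncrossed ends G W"
  by (auto simp: uncrossed_def)

lemma uncrossed_mono: "uncrossed ends F W \<Longrightarrow> G \<subseteq> F \<Longrightarrow> uncrossed ends G W"
  by (auto simp: uncrossed_def)

lemma uncrossed_Int: "uncrossed ends F W \<Longrightarrow> uncrossed ends F U \<Longrightarrow> uncrossed ends F (W \<inter> U)"
  unfolding uncrossed_def by blast

lemma uncrossed_sym_diff:
  "uncrossed ends F W \<Longrightarrow> uncrossed ends F U \<Longrightarrow> uncrossed ends F ((W - U) \<union> (U - W))"
  unfolding uncrossed_def by blast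

lemma uncrossed_compl:
  assumes "uncrossed ends F W" "\<And>e. e \<in> F \<Longrightarrow> ends e \<subseteq> V"
  shows "uncrossed ends F (V - W)"
  using assms unfolding uncrossed_def by blast

text \<open>An uncrossed set cannot be left along an edge, so it absorbs everything reachable from
  its elements; conversely, the set of vertices reachable from \<open>u\<close> is itself
  uncrossed.\<close>

lemma graph_connected_iff_uncrossed:
  assumes "\<And>e. e \<in> F \<Longrightarrow> ends e \<subseteq> V \<and> card (ends e) = 2"
  shows "graph_connected V ends F \<longleftrightarrow>
    V \<noteq> {} \<and> (\<forall>W\<subseteq>V. uncrossed ends F W \<longrightarrow> W = {} \<or> W = V)"
proof -
  let ?R = "\<lambda>x y. \<exists>e\<in>F. ends e = {x, y}"
  have "W = V" if conn: "\<And>u v. u \<in> V \<Longrightarrow> v \<in> V \<Longrightarrow> ?R\<^sup>*\<^sup>* u v"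
    and W: "W \<subseteq> V" "uncrossed ends F W" "u \<in> W" for W u
  proof -
    have "v \<in> W" if "?R\<^sup>*\<^sup>* u v" for v
      using that
    proof (induction rule: rtranclp_induct)
      case base
      show ?case by (rule W(3))
    next
      case (step y z)
      then show ?case using W(2) unfolding uncrossed_def by force
    qed
    then show ?thesis using conn W(1,3) by blast
  qed
  moreover have "?R\<^sup>*\<^sup>* u v"
    if triv: "\<forall>W\<subseteq>V. uncrossed ends F W \<longrightarrow> W = {} \<or> W = V" and uv: "u \<in> V" "v \<in> V" for u v
  proof -
    let ?W = "{y \<in> V. ?R\<^sup>*\<^sup>* u y}"
    have "uncrossed ends F ?W"
      unfolding uncrossed_def
    proof
      fix e assume e: "e \<in> F"
      then obtain p q where pq: "ends e = {p, q}" using assms by (meson card_2_iff)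
      then have "p \<in> V" "q \<in> V" using assms e by auto
      moreover have "?R p q" "?R q p" using pq e by (auto simp: insert_commute)
      then have "?R\<^sup>*\<^sup>* u p \<longleftrightarrow> ?R\<^sup>*\<^sup>* u q"
        by (intro iffI) (erule rtranclp.rtrancl_into_rtrancl, assumption)+
      ultimately show "ends e \<subseteq> ?W \<or> ends e \<inter> ?W = {}"
        unfolding pq by simp
    qed
    then have "?W = {} \<or> ?W = V" by (intro triv[rule_format]) auto
    moreover have "u \<in> ?W" using uv by simp
    ultimately have "v \<in> ?W" using uv(2) by blast
    then show ?thesis by simp
  qed
  ultimately show ?thesis unfolding graph_connected_def by blast
qed

lemma graph_connected_mono:
  assumes "graph_connected V ends F" "F \<subseteq> G"
  shows "graph_connected V ends G"
proof -
  have "(\<lambda>x y. \<exists>e\<in>G. ends e = {x, y})\<^sup>*\<^sup>* u v" if "u \<in> V" "v \<in> V" for u v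
  proof (rule mono_rtranclp[rule_format])
    show "(\<lambda>x y. \<exists>e\<in>F. ends e = {x, y})\<^sup>*\<^sup>* u v"
      using assms(1) that by (simp add: graph_connected_def)
  qed (use assms(2) in blast)
  then show ?thesis using assms(1) by (simp add: graph_connected_def)
qed

text \<open>The edges of \<open>P\<close> partition \<open>W\<close> into pairs.\<close>

lemma even_card_if_matched:
  assumes "finite P" "\<And>e. e \<in> P \<Longrightarrow> card (ends e) = 2" "\<And>e. e \<in> P \<Longrightarrow> ends e \<subseteq> W"
    and "\<And>v. v \<in> W \<Longrightarrow> \<exists>!e. e \<in> P \<and> v \<in> ends e"
  shows "even (card W)"
proof -
  have ex: "\<exists>e\<in>P. v \<in> ends e" if "v \<in> W" for v using assms(4)[OF that] by blast
  have uniq: "e = f" if "e \<in> P" "f \<in> P" "v \<in> ends e" "v \<in> ends f" for e f v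
  proof -
    have "v \<in> W" using that assms(3) by blast
    then show ?thesis using assms(4)[of v] that by blast
  qed
  have "W = (\<Union>e\<in>P. ends e)" using assms(3) ex by blast
  also have "card \<dots> = (\<Sum>e\<in>P. card (ends e))"
  proof (rule card_UN_disjoint)
    show "\<forall>e\<in>P. finite (ends e)" using assms(2) card.infinite by fastforce
    show "\<forall>e\<in>P. \<forall>f\<in>P. e \<noteq> f \<longrightarrow> ends e \<inter> ends f = {}" using uniq by blast
  qed (rule assms(1))
  also have "\<dots> = 2 * card P" using assms(2) by simp
  finally show ?thesis by simp
qed

text \<open>Parity: the edges of \<open>M\<close> inside \<open>W\<close> match all of
  \<open>W\<close>, so \<open>card W\<close> is even. If \<open>e\<close> is the only edge of
  \<open>N\<close> that crosses \<open>W\<close>, then the edges of \<open>N\<close> inside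
  \<open>W\<close> match \<open>W - {p}\<close>, which would then be even too.\<close>

lemma not_crossed_once:
  assumes "finite V" "finite E" "\<And>e. e \<in> E \<Longrightarrow> ends e \<subseteq> V \<and> card (ends e) = 2"
    and M: "perfect_matching V ends E M" "uncrossed ends M W" and W: "W \<subseteq> V"
    and N: "perfect_matching V ends E N" "uncrossed ends (N - {e}) W"
    and e: "e \<in> N" "ends e = {p, q}" "p \<in> W" "q \<notin> W"
  shows False
proof -
  have sub: "M \<subseteq> E" "N \<subseteq> E" using M(1) N(1) by (auto simp: perfect_matching_def)
  have fin: "finite M" "finite N" "finite W" using sub assms(1,2) W finite_subset by blast+
  have "even (card W)"
  proof (rule even_card_if_matched)
    show "finite {f \<in> M. ends f \<subseteq> W}" using fin by simp
    fix v assume v: "v \<in> W"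
    then have "\<exists>!f. f \<in> M \<and> v \<in> ends f" using M(1) W unfolding perfect_matching_def by blast
    moreover have "ends f \<subseteq> W" if "f \<in> M" "v \<in> ends f" for f
      using M(2) that v unfolding uncrossed_def by blast
    ultimately show "\<exists>!f. f \<in> {f \<in> M. ends f \<subseteq> W} \<and> v \<in> ends f" by blast
  qed (use assms(3) sub in auto)
  moreover have "even (card (W - {p}))"
  proof (rule even_card_if_matched)
    show "finite {f \<in> N - {e}. ends f \<subseteq> W}" using fin by simp
    show "ends f \<subseteq> W - {p}" if "f \<in> {f \<in> N - {e}. ends f \<subseteq> W}" for f
      using N(1) that W e unfolding perfect_matching_def by blast
    fix v assume v: "v \<in> W - {p}"
    then have "\<exists>!f. f \<in> N \<and> v \<in> ends f" using N(1) W unfolding perfect_matching_def by blast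
    moreover have "ends f \<subseteq> W \<and> f \<noteq> e" if "f \<in> N" "v \<in> ends f" for f
      using N(2) that v e unfolding uncrossed_def by blast
    ultimately show "\<exists>!f. f \<in> {f \<in> N - {e}. ends f \<subseteq> W} \<and> v \<in> ends f" by blast
  qed (use assms(3) sub in auto)
  moreover have "card W = Suc (card (W - {p}))"
    using card.remove[OF fin(3) e(3)] .
  ultimately show False by simp
qed

section \<open>Squares and cycles\<close>

lemma four_cycle_labels:
  assumes "four_cycle ends C" "P \<noteq> Q" "square_matchings ends C = {P, Q}"
  obtains a b x d e0 e1 e2 e3 where "P = {e0, e2}" "Q = {e1, e3}" "C = {e0, e1, e2, e3}"
    "verts_of ends C = {a, b, x, d}" "distinct [a, b, x, d]" "distinct [e0, e1, e2, e3]"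
    "ends e0 = {a, b}" "ends e1 = {b, x}" "ends e2 = {x, d}" "ends e3 = {d, a}"
proof -
  obtain vs es where vs: "distinct vs" "set vs = verts_of ends C"
    and es: "distinct es" "set es = C" and len: "length es = length vs"
    and inc: "\<forall>i < length vs. ends (es ! i) = {vs ! i, vs ! (Suc i mod length vs)}"
    using assms unfolding four_cycle_def cycle_on_def by blast
  have "length es = 4"
    using assms es unfolding four_cycle_def by (metis distinct_card)
  then obtain e0 e1 e2 e3 where e: "es = [e0, e1, e2, e3]"
    by (auto simp: numeral_eq_Suc length_Suc_conv)
  have "length vs = 4" using len \<open>length es = 4\<close> by simp
  then obtain a b x d where v: "vs = [a, b, x, d]"
    by (auto simp: numeral_eq_Suc length_Suc_conv)
  have ends: "ends e0 = {a, b}" "ends e1 = {b, x}" "ends e2 = {x, d}" "ends e3 = {d, a}"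
    using inc[rule_format, of 0] inc[rule_format, of "Suc 0"] inc[rule_format, of "Suc (Suc 0)"]
      inc[rule_format, of "Suc (Suc (Suc 0))"] by (simp_all add: e v)
  have dv: "distinct [a, b, x, d]" and de: "distinct [e0, e1, e2, e3]"
    using vs(1) v es(1) e by auto
  have C: "C = {e0, e1, e2, e3}" and W: "verts_of ends C = {a, b, x, d}"
    using es(2) e vs(2) v by auto
  have "perfect_matching {a, b, x, d} ends C {e0, e2}" "perfect_matching {a, b, x, d} ends C {e1, e3}"
    using dv de ends by (auto simp: perfect_matching_def C)
  then have "{e0, e2} \<in> square_matchings ends C" "{e1, e3} \<in> square_matchings ends C"
    by (simp_all add: square_matchings_def W)
  moreover have "{e0, e2} \<noteq> {e1, e3}" using de by auto
  ultimately consider "P = {e0, e2}" "Q = {e1, e3}" | "P = {e1, e3}" "Q = {e0, e2}"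
    unfolding assms(3) by (metis insertE singletonD)
  then show thesis
  proof cases
    case 1
    show thesis by (rule that[OF 1 C W dv de ends])
  next
    case 2
    show thesis
      \<comment> \<open>Rotates the labelling of the cycle by one place. The terms follow the first
        occurrences in the premises: \<open>e0\<close>, \<open>e2\<close>, \<open>e1\<close>,
        \<open>e3\<close>, then \<open>a\<close>, \<open>b\<close>, \<open>x\<close>,
        \<open>d\<close>.\<close>
      by (rule that[of e1 e3 e2 e0 b x d a]) (use 2 C W dv de ends in auto)
  qed
qed

lemma square_matchings_compl:
  assumes "four_cycle ends C" "P \<in> square_matchings ends C"
  shows "square_matchings ends C = {P, C - P}" "P \<noteq> C - P" "P \<subseteq> C"
proof -
  obtain A B where AB: "A \<noteq> B" "A \<union> B = C" "A \<inter> B = {}" "card A = 2" "card B = 2"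
    "square_matchings ends C = {A, B}"
    using assms(1) by (rule four_cycle_matchings)
  then have "P = A \<and> C - P = B \<or> P = B \<and> C - P = A" using assms(2) by auto
  then show "square_matchings ends C = {P, C - P}" "P \<noteq> C - P" "P \<subseteq> C" using AB by auto
qed

lemma cycle_on_incident:
  assumes "cycle_on W ends F" "v \<in> W"
  obtains f g where "f \<noteq> g" "{e \<in> F. v \<in> ends e} = {f, g}"
proof -
  obtain vs es where vs: "distinct vs" "set vs = W" and es: "distinct es" "set es = F"
    and len: "length es = length vs" "2 \<le> length vs"
    and inc: "\<And>i. i < length vs \<Longrightarrow> ends (es ! i) = {vs ! i, vs ! (Suc i mod length vs)}"
    using assms(1) unfolding cycle_on_def by blast
  obtain i where i: "i < length vs" "v = vs ! i" using assms(2) vs(2) by (metis in_set_conv_nth)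
  \<comment> \<open>The cyclic predecessor of \<open>i\<close>: the vertex at \<open>i\<close> is
    met by the edges at \<open>i\<close> and \<open>k\<close>, which are different because the
    length is at least two.\<close>
  define k where "k = (if i = 0 then length vs - 1 else i - 1)"
  have k: "k < length vs" "k \<noteq> i" using i len by (auto simp: k_def)
  have "v \<in> ends (es ! j) \<longleftrightarrow> j = i \<or> j = k" if j: "j < length vs" for j
  proof -
    have "v \<in> ends (es ! j) \<longleftrightarrow> i = j \<or> i = Suc j mod length vs"
    proof -
      have "Suc j mod length vs < length vs" by (rule mod_less_divisor) (use j in linarith)
      from nth_eq_iff_index_eq[OF vs(1) i(1) this] nth_eq_iff_index_eq[OF vs(1) i(1) j]
      show ?thesis unfolding inc[OF j] i(2) by blast
    qed
    moreover have "i = Suc j mod length vs \<longleftrightarrow> j = k"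
      using i j len by (cases "Suc j = length vs") (auto simp: k_def)
    ultimately show ?thesis by blast
  qed
  then have "{e \<in> F. v \<in> ends e} = {es ! i, es ! k}"
    using es(2) i(1) k(1) len(1) by (auto simp: in_set_conv_nth)
  moreover have "es ! i \<noteq> es ! k" using es(1) i(1) k len by (simp add: nth_eq_iff_index_eq)
  ultimately show thesis using that by blast
qed

text \<open>Membership in an uncrossed set passes from each vertex of the list to the next.\<close>

lemma cycle_on_connected:
  assumes "cycle_on V ends F" "\<And>e. e \<in> F \<Longrightarrow> ends e \<subseteq> V \<and> card (ends e) = 2"
  shows "graph_connected V ends F"
proof -
  obtain vs es where vs: "set vs = V" and es: "set es = F"
    and len: "length es = length vs" "2 \<le> length vs"
    and inc: "\<And>i. i < length vs \<Longrightarrow> ends (es ! i) = {vs ! i, vs ! (Suc i mod length vs)}"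
    using assms(1) unfolding cycle_on_def by blast
  have "W = {} \<or> W = V" if W: "W \<subseteq> V" "uncrossed ends F W" for W
  proof -
    have const: "vs ! i \<in> W \<longleftrightarrow> vs ! 0 \<in> W" if "i < length vs" for i
      using that
    proof (induction i)
      case (Suc i)
      then have "es ! i \<in> F" using es len by auto
      moreover have "ends (es ! i) = {vs ! i, vs ! Suc i}" using inc[of i] Suc.prems by simp
      ultimately have "vs ! i \<in> W \<longleftrightarrow> vs ! Suc i \<in> W" using W(2) by (auto simp: uncrossed_def)
      then show ?case using Suc by simp
    qed simp
    show ?thesis
    proof (cases "vs ! 0 \<in> W")
      case True
      then have "V \<subseteq> W" using const vs by (metis in_set_conv_nth subsetI)
      then show ?thesis using W(1) by blast
    next
      case False
      then have "v \<notin> W" if "v \<in> V" for v using const vs that by (metis in_set_conv_nth)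
      then show ?thesis using W(1) by blast
    qed
  qed
  moreover have "V \<noteq> {}" using vs len by auto
  ultimately show ?thesis using graph_connected_iff_uncrossed[of F ends V, OF assms(2)] by blast
qed

section \<open>Longest paths, and connected 2-regular graphs as cycles\<close>

definition edge_path :: "('e \<Rightarrow> 'v set) \<Rightarrow> 'e set \<Rightarrow> 'v list \<Rightarrow> 'e list \<Rightarrow> bool" where
  "edge_path ends F vs es \<longleftrightarrow> distinct vs \<and> length vs = Suc (length es) \<and> set es \<subseteq> F \<and>
     (\<forall>i < length es. ends (es ! i) = {vs ! i, vs ! Suc i})"

lemma edge_path_incident:
  assumes "edge_path ends F vs es" "i < length es" "j \<le> length es"
  shows "vs ! j \<in> ends (es ! i) \<longleftrightarrow> j = i \<or> j = Suc i"
  using assms by (simp add: edge_path_def nth_eq_iff_index_eq)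

text \<open>The vertices of the path that an edge contains, those at \<open>i\<close> and
  \<open>Suc i\<close>, determine its index.\<close>

lemma edge_path_distinct:
  assumes "edge_path ends F vs es"
  shows "distinct es"
  unfolding distinct_conv_nth
proof (intro allI impI notI)
  fix i j assume ij: "i < length es" "j < length es" "i \<noteq> j" "es ! i = es ! j"
  have "vs ! i \<in> ends (es ! j)" "vs ! Suc i \<in> ends (es ! j)"
    using edge_path_incident[OF assms ij(1), of i] edge_path_incident[OF assms ij(1), of "Suc i"] ij
    by auto
  then show False
    using edge_path_incident[OF assms ij(2), of i] edge_path_incident[OF assms ij(2), of "Suc i"] ij
    by auto
qed

lemma longest_edge_path:
  assumes "finite V" "V \<noteq> {}"
  obtains vs es where "edge_path ends F vs es" "set vs \<subseteq> V"
    "\<And>vs' es'. edge_path ends F vs' es' \<Longrightarrow> set vs' \<subseteq> V \<Longrightarrow> length es' \<le> length es"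
proof -
  let ?P = "\<lambda>p. edge_path ends F (fst p) (snd p) \<and> set (fst p) \<subseteq> V"
  obtain v where "v \<in> V" using assms(2) by blast
  then have "?P ([v], [])" by (simp add: edge_path_def)
  moreover have "length (snd p) \<le> card V" if "?P p" for p
  proof -
    have "card (set (fst p)) = Suc (length (snd p))"
      using that by (simp add: edge_path_def distinct_card)
    then show ?thesis using card_mono[OF assms(1), of "set (fst p)"] that by simp
  qed
  ultimately have "\<exists>p. ?P p \<and> (\<forall>q. ?P q \<longrightarrow> length (snd q) \<le> length (snd p))"
    by (intro ex_has_greatest_nat[where k = "([v], [])" and b = "Suc (card V)"])
      (auto simp: less_Suc_eq_le)
  then show thesis using that by fastforce
qed

text \<open>The last vertex \<open>z\<close> of a longest path has an edge \<open>f\<close> off the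
  path. By maximality its other end lies on the path, and by the degrees it is the first vertex. The
  closed cycle uses up both edges at each of its vertices, so it is a component, hence
  everything.\<close>

lemma cycle_if_connected_2_regular:
  assumes "finite V" and ends: "\<And>e. e \<in> F \<Longrightarrow> ends e \<subseteq> V \<and> card (ends e) = 2"
    and conn: "graph_connected V ends F" and deg: "\<And>v. v \<in> V \<Longrightarrow> card {e \<in> F. v \<in> ends e} = 2"
  shows "cycle_on V ends F"
proof -
  have "V \<noteq> {}" using conn by (simp add: graph_connected_def)
  then obtain vs es where path: "edge_path ends F vs es" and vs: "set vs \<subseteq> V"
    and longest: "\<And>vs' es'. edge_path ends F vs' es' \<Longrightarrow> set vs' \<subseteq> V \<Longrightarrow> length es' \<le> length es"
    using longest_edge_path[OF assms(1)] by metis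
  have es: "set es \<subseteq> F" and len: "length vs = Suc (length es)" and dist: "distinct vs"
    and inc: "\<And>i. i < length es \<Longrightarrow> ends (es ! i) = {vs ! i, vs ! Suc i}"
    using path by (auto simp: edge_path_def)
  note incident = edge_path_incident[OF path] and dist_es = edge_path_distinct[OF path]
  define n where "n = length es"
  define z where "z = vs ! n"
  have z: "z \<in> V" using vs len by (auto simp: z_def n_def)
  \<comment> \<open>At most one of the two edges at \<open>z\<close> is on the path. For
    \<open>n = 0\<close> the claim is vacuous, since \<open>es\<close> is empty.\<close>
  have last: "e = es ! (n - 1)" if e: "e \<in> set es" "z \<in> ends e" for e
  proof -
    obtain i where "i < n" "e = es ! i" using e(1) unfolding n_def in_set_conv_nth by blast
    then show ?thesis using incident[of i n] e(2) by (auto simp: z_def n_def)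
  qed
  obtain f where f: "f \<in> F" "z \<in> ends f" "f \<notin> set es"
  proof -
    obtain g h where gh: "{e \<in> F. z \<in> ends e} = {g, h}" "g \<noteq> h"
      using deg[OF z] unfolding card_2_iff by blast
    have "g \<in> F" "z \<in> ends g" "h \<in> F" "z \<in> ends h" using gh(1) by blast+
    moreover have "g \<notin> set es \<or> h \<notin> set es" using calculation gh(2) last by metis
    ultimately show thesis using that by blast
  qed
  obtain u where u: "ends f = {z, u}" "u \<noteq> z" "u \<in> V"
  proof -
    obtain p q where "ends f = {p, q}" "p \<noteq> q" using ends[OF f(1)] unfolding card_2_iff by blast
    then show thesis using that[of p] that[of q] f(2) ends[OF f(1)] by (auto simp: insert_commute)
  qed
  have "u \<in> set vs"
  proof (rule ccontr)
    assume "u \<notin> set vs"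
    then have "edge_path ends F (vs @ [u]) (es @ [f])"
      using dist len es f(1) u(1) inc by (auto simp: edge_path_def nth_append z_def n_def less_Suc_eq)
    then show False using longest[of "vs @ [u]" "es @ [f]"] vs u(3) by simp
  qed
  then obtain i where "i < length vs" and ui: "u = vs ! i" by (metis in_set_conv_nth)
  moreover have "i \<noteq> n" using u(2) ui by (auto simp: z_def)
  ultimately have i: "i < n" using len by (simp add: n_def)
  have "i = 0"
  proof (rule ccontr)
    assume "i \<noteq> 0"
    \<comment> \<open>An inner vertex of the path would carry three edges: its two path edges and
      \<open>f\<close>.\<close>
    let ?A = "{es ! (i - 1), es ! i, f}"
    have "es ! (i - 1) \<noteq> es ! i" using dist_es i \<open>i \<noteq> 0\<close> by (simp add: nth_eq_iff_index_eq n_def)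
    moreover have mem: "es ! (i - 1) \<in> set es" "es ! i \<in> set es" using i by (auto simp: n_def)
    moreover have "es ! (i - 1) \<noteq> f" "es ! i \<noteq> f" using mem f(3) by metis+
    ultimately have "card ?A = 3" by (simp add: card_insert_if)
    moreover have "?A \<subseteq> {e \<in> F. u \<in> ends e}"
      using mem es f(1) u(1) incident[of "i - 1" i] incident[of i i] i \<open>i \<noteq> 0\<close> ui
      by (auto simp: n_def)
    moreover have "card {e \<in> F. u \<in> ends e} = 2" using deg u(3) by blast
    moreover from this have "finite {e \<in> F. u \<in> ends e}" by (intro card_ge_0_finite) linarith
    ultimately show False
      using card_mono[of "{e \<in> F. u \<in> ends e}" ?A] by simp
  qed
  define fs where "fs = es @ [f]"
  \<comment> \<open>Thus \<open>fs\<close> has at least two edges; for \<open>n = 1\<close> it is a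
    pair of parallel edges.\<close>
  have n: "n > 0" using i by simp
  have fs: "distinct fs" "set fs \<subseteq> F" "length fs = length vs" "length vs = Suc n"
    using dist_es f es len by (auto simp: fs_def n_def)
  have cyc: "ends (fs ! j) = {vs ! j, vs ! (Suc j mod length vs)}" if "j < length vs" for j
  proof (cases "j = n")
    case True
    then show ?thesis using u(1) ui \<open>i = 0\<close> fs(4) by (simp add: fs_def nth_append n_def z_def)
  next
    case False
    then show ?thesis using inc[of j] that fs(4) by (simp add: fs_def nth_append n_def)
  qed
  have all_fs: "e \<in> set fs" if "v \<in> set vs" "e \<in> F" "v \<in> ends e" for v e
  proof -
    obtain j where j: "j < length vs" "v = vs ! j" using \<open>v \<in> set vs\<close> by (metis in_set_conv_nth)
    \<comment> \<open>The cyclic predecessor again: the cycle edges at \<open>j\<close> and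
      \<open>k\<close> exhaust the degree of \<open>v\<close>, so no other edge of \<open>F\<close>
      meets \<open>v\<close>.\<close>
    define k where "k = (if j = 0 then n else j - 1)"
    have k: "k < length vs" "k \<noteq> j" "Suc k mod length vs = j"
      using j fs(4) n by (auto simp: k_def)
    have "{fs ! j, fs ! k} \<subseteq> {e \<in> F. v \<in> ends e}"
      using cyc[OF j(1)] cyc[OF k(1)] k(1,3) j fs(2,3) nth_mem[of _ fs] by auto
    moreover have "card {fs ! j, fs ! k} = 2"
      using k j fs by (simp add: nth_eq_iff_index_eq)
    moreover have "card {e \<in> F. v \<in> ends e} = 2" using deg that(1) vs by blast
    ultimately have "{fs ! j, fs ! k} = {e \<in> F. v \<in> ends e}"
      by (metis card.infinite card_subset_eq zero_neq_numeral)
    then have "e = fs ! j \<or> e = fs ! k" using that by blast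
    then show ?thesis using j k fs by auto
  qed
  have ends_fs: "ends e \<subseteq> set vs" if e: "e \<in> set fs" for e
  proof -
    obtain j where j: "j < length vs" "e = fs ! j" using e fs(3) by (metis in_set_conv_nth)
    moreover have "Suc j mod length vs < length vs" using fs(4) by simp
    ultimately show ?thesis using cyc[OF j(1)] by simp
  qed
  have "uncrossed ends F (set vs)"
    using all_fs ends_fs unfolding uncrossed_def by blast
  moreover have "set vs \<noteq> {}" using len by auto
  ultimately have V: "set vs = V"
    using conn vs graph_connected_iff_uncrossed[of F ends V, OF ends] by blast
  have "F \<subseteq> set fs"
  proof
    fix e assume e: "e \<in> F"
    then obtain v where "v \<in> ends e" using ends by fastforce
    then show "e \<in> set fs" using all_fs e ends V by blast
  qed
  then have "set fs = F" using fs(2) by blast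
  moreover have "2 \<le> length vs" using fs(4) n by simp
  ultimately show ?thesis
    unfolding cycle_on_def
    by (intro exI[of _ vs] exI[of _ fs] conjI allI impI dist V fs(1,3) cyc)
qed

section \<open>Connected selections\<close>

text \<open>Symmetric difference. If \<open>F\<close> contains exactly one of the two matchings of
  the square \<open>C\<close>, this exchanges it for the other.\<close>

definition swap :: "'e set \<Rightarrow> 'e set \<Rightarrow> 'e set" where
  "swap F C = (F - C) \<union> (C - F)"

text \<open>Cubicity enters as \<open>covered\<close>: each vertex has an edge outside
  \<open>M\<close>, hence lies on a square. Connectivity is kept out, since it is asked of varying
  subgraphs.\<close>

locale squares =
  fixes V :: "'v set" and E M :: "'e set" and ends :: "'e \<Rightarrow> 'v set" and S :: "'e set set"
  assumes finite_V: "finite V" and finite_E: "finite E"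
    and ends_V: "e \<in> E \<Longrightarrow> ends e \<subseteq> V" and card_ends: "e \<in> E \<Longrightarrow> card (ends e) = 2"
    and matching_M: "perfect_matching V ends E M"
    and decomposition: "square_decomposition ends (E - M) S"
    and covered: "v \<in> V \<Longrightarrow> \<exists>C\<in>S. v \<in> verts_of ends C"
begin

lemma M_sub: "M \<subseteq> E"
  using matching_M by (simp add: perfect_matching_def)

lemma square_sub: "C \<in> S \<Longrightarrow> C \<subseteq> E - M"
  using decomposition by (auto simp: square_decomposition_def)

lemma four_cycle: "C \<in> S \<Longrightarrow> four_cycle ends C"
  using decomposition by (auto simp: square_decomposition_def)

lemma in_square: "e \<in> E \<Longrightarrow> e \<notin> M \<Longrightarrow> \<exists>C\<in>S. e \<in> C"
  using decomposition by (auto simp: square_decomposition_def)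

lemma verts_disjoint:
  "C \<in> S \<Longrightarrow> D \<in> S \<Longrightarrow> v \<in> verts_of ends C \<Longrightarrow> v \<in> verts_of ends D \<Longrightarrow> C = D"
  using decomposition unfolding square_decomposition_def by blast

lemma squares_disjoint:
  assumes "C \<in> S" "D \<in> S" "C \<noteq> D"
  shows "C \<inter> D = {}"
proof (rule ccontr)
  assume "C \<inter> D \<noteq> {}"
  then obtain e where e: "e \<in> C" "e \<in> D" by blast
  then have "card (ends e) = 2" using card_ends square_sub assms by blast
  then obtain v where "v \<in> ends e" by fastforce
  then have "v \<in> verts_of ends C" "v \<in> verts_of ends D" using e by (auto simp: verts_of_def)
  then show False using verts_disjoint assms by blast
qed

text \<open>The vertex sets of the squares are disjoint and cover \<open>V\<close>, so matchings
  chosen independently in the squares fit together.\<close>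

lemma matching_from_squares:
  assumes "\<And>C. C \<in> S \<Longrightarrow> f C \<in> square_matchings ends C"
  shows "perfect_matching V ends E (\<Union>C\<in>S. f C)"
  unfolding perfect_matching_def
proof (intro conjI ballI)
  have sub: "f C \<subseteq> C" if "C \<in> S" for C
    using assms[OF that] by (auto simp: square_matchings_def perfect_matching_def)
  then show "(\<Union>C\<in>S. f C) \<subseteq> E" using square_sub by blast
  fix v assume "v \<in> V"
  then obtain C where C: "C \<in> S" "v \<in> verts_of ends C" using covered by blast
  then obtain e where e: "e \<in> f C" "v \<in> ends e" "\<And>e'. e' \<in> f C \<Longrightarrow> v \<in> ends e' \<Longrightarrow> e' = e"
    using assms[OF C(1)] unfolding square_matchings_def perfect_matching_def by blast
  have same: "D = C" if "D \<in> S" "e \<in> f D" "v \<in> ends e" for D e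
  proof (rule verts_disjoint[OF that(1) C(1) _ C(2)])
    show "v \<in> verts_of ends D" using that sub unfolding verts_of_def by blast
  qed
  show "\<exists>!e. e \<in> (\<Union>C\<in>S. f C) \<and> v \<in> ends e"
  proof (rule ex1I[of _ e])
    show "e \<in> (\<Union>C\<in>S. f C) \<and> v \<in> ends e" using C(1) e(1,2) by blast
    show "e' = e" if e': "e' \<in> (\<Union>C\<in>S. f C) \<and> v \<in> ends e'" for e'
      using e' same e(3) by blast
  qed
qed

lemma connected_iff:
  assumes "F \<subseteq> E"
  shows "graph_connected V ends F \<longleftrightarrow>
    V \<noteq> {} \<and> (\<forall>W\<subseteq>V. uncrossed ends F W \<longrightarrow> W = {} \<or> W = V)"
  by (rule graph_connected_iff_uncrossed) (use assms ends_V card_ends in blast)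

text \<open>The parity lemma \<open>not_crossed_once\<close> applied to both orientations of
  \<open>e\<close>.\<close>

lemma crossed_once:
  assumes "W \<subseteq> V" "uncrossed ends M W" "perfect_matching V ends E N" "uncrossed ends (N - {e}) W"
    and "e \<in> N" "ends e = {p, q}"
  shows "p \<in> W \<longleftrightarrow> q \<in> W"
proof -
  have E: "ends f \<subseteq> V \<and> card (ends f) = 2" if "f \<in> E" for f
    using that ends_V card_ends by blast
  have e: "ends e = {q, p}" using assms(6) by blast
  show ?thesis
    using not_crossed_once[OF finite_V finite_E E matching_M assms(2,1,3-6)]
      not_crossed_once[OF finite_V finite_E E matching_M assms(2,1,3-5) e] by blast
qed

text \<open>
  If both choices disconnect, the two witnessing vertex sets meet in a set that contains exactly
  one vertex of the square, and parity excludes this.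
\<close>

lemma some_choice_connected:
  assumes conn: "graph_connected V ends H" and H: "M \<subseteq> H" "H \<subseteq> E" and C: "C \<in> S" "C \<subseteq> H"
    and sel: "\<And>D. D \<in> S \<Longrightarrow> \<exists>P\<in>square_matchings ends D. P \<subseteq> H"
  shows "\<exists>P\<in>square_matchings ends C. graph_connected V ends (H - P)"
proof (rule ccontr)
  assume contr: "\<not> ?thesis"
  obtain P Q where PQ: "P \<noteq> Q" "square_matchings ends C = {P, Q}"
    using four_cycle_matchings[OF four_cycle[OF C(1)]] by metis
  obtain a b x d e0 e1 e2 e3 where L: "P = {e0, e2}" "Q = {e1, e3}" "C = {e0, e1, e2, e3}"
    "verts_of ends C = {a, b, x, d}" "distinct [a, b, x, d]" "distinct [e0, e1, e2, e3]"
    and ends: "ends e0 = {a, b}" "ends e1 = {b, x}" "ends e2 = {x, d}" "ends e3 = {d, a}"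
    by (rule four_cycle_labels[OF four_cycle[OF C(1)] PQ])
  have V: "V \<noteq> {}" and triv: "\<And>W. W \<subseteq> V \<Longrightarrow> uncrossed ends H W \<Longrightarrow> W = {} \<or> W = V"
    using conn connected_iff[OF H(2)] by blast+
  have "\<not> graph_connected V ends (H - P)" "\<not> graph_connected V ends (H - Q)"
    using contr PQ(2) by auto
  moreover have "H - P \<subseteq> E" "H - Q \<subseteq> E" using H(2) by auto
  ultimately obtain W U where W: "W \<subseteq> V" "uncrossed ends (H - P) W" "W \<noteq> {}" "W \<noteq> V"
    and U: "U \<subseteq> V" "uncrossed ends (H - Q) U" "U \<noteq> {}" "U \<noteq> V"
    using connected_iff V by metis
  have "\<not> uncrossed ends H W" "\<not> uncrossed ends H U" using triv W U by blast+
  moreover have "H = (H - P) \<union> P" "H = (H - Q) \<union> Q" using C L by auto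
  ultimately have "\<not> uncrossed ends P W" "\<not> uncrossed ends Q U"
    using W(2) U(2) uncrossed_Un by metis+
  moreover have "uncrossed ends Q W" "uncrossed ends P U"
    using W(2) U(2) L C(2) by (auto elim!: uncrossed_mono)
  \<comment> \<open>As \<open>H\<close> is connected, an edge of \<open>P\<close> crosses
    \<open>W\<close> while \<open>Q\<close> does not, and conversely for \<open>U\<close>. So
    \<open>W\<close> separates \<open>a\<close>, \<open>d\<close> from \<open>b\<close>,
    \<open>x\<close>, and \<open>U\<close> separates \<open>a\<close>, \<open>b\<close> from
    \<open>x\<close>, \<open>d\<close>; exactly one vertex of the square is in
    \<open>W \<inter> U\<close>.\<close>
  ultimately have WU: "b \<in> W \<longleftrightarrow> x \<in> W" "d \<in> W \<longleftrightarrow> a \<in> W" "a \<in> W \<longleftrightarrow> b \<notin> W"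
    "a \<in> U \<longleftrightarrow> b \<in> U" "x \<in> U \<longleftrightarrow> d \<in> U" "a \<in> U \<longleftrightarrow> d \<notin> U"
    unfolding uncrossed_def L(1,2) by (auto simp: ends)
  let ?W = "W \<inter> U"
  have unc: "uncrossed ends (H - C) ?W"
    by (rule uncrossed_Int) (use W(2) U(2) L in \<open>auto elim!: uncrossed_mono\<close>)
  obtain g where g: "\<And>D. D \<in> S \<Longrightarrow> g D \<in> square_matchings ends D \<and> g D \<subseteq> H"
    using sel by metis
  \<comment> \<open>The perfect matching for the parity argument: \<open>P\<close> on
    \<open>C\<close> and a matching still present in \<open>H\<close> on each other square. Outside
    \<open>C\<close> it lies in \<open>H - C\<close>, which does not cross
    \<open>W \<inter> U\<close>.\<close>
  define f where "f = g(C := P)"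
  define N where "N = (\<Union>D\<in>S. f D)"
  have f: "f D \<in> square_matchings ends D" if "D \<in> S" for D
    using g that PQ(2) by (auto simp: f_def)
  have N: "perfect_matching V ends E N"
    unfolding N_def by (rule matching_from_squares) (rule f)
  have e02: "e0 \<in> N" "e2 \<in> N" using C(1) L(1) by (auto simp: N_def f_def)
  have "f D \<inter> C = {} \<and> f D \<subseteq> H" if "D \<in> S" "D \<noteq> C" for D
  proof -
    have "f D \<subseteq> D" using f[OF that(1)] by (simp add: square_matchings_def perfect_matching_def)
    moreover have "f D \<subseteq> H" using g that by (simp add: f_def)
    ultimately show ?thesis using squares_disjoint[OF that(1) C(1) that(2)] by blast
  qed
  then have "N \<subseteq> (H - C) \<union> P" by (auto simp: N_def f_def)
  then have N': "N - {e0} \<subseteq> (H - C) \<union> {e2}" "N - {e2} \<subseteq> (H - C) \<union> {e0}" using L(1) by auto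
  have M: "uncrossed ends M ?W"
    by (rule uncrossed_mono[OF unc]) (use H(1) square_sub C(1) in blast)
  \<comment> \<open>One edge of \<open>P\<close> contains the single vertex of the square in
    \<open>?W\<close> and is the only edge of \<open>N\<close> crossing \<open>?W\<close>; the cases
    tell which.\<close>
  consider "a \<notin> ?W \<and> b \<notin> ?W" | "x \<notin> ?W \<and> d \<notin> ?W" using WU by blast
  then show False
  proof cases
    case 1
    then have "uncrossed ends {e0} ?W" by (auto simp: uncrossed_def ends)
    then have "uncrossed ends (N - {e2}) ?W" using unc N' uncrossed_Un uncrossed_mono by metis
    then have "x \<in> ?W \<longleftrightarrow> d \<in> ?W" using crossed_once[OF _ M N _ e02(2) ends(3)] W by blast
    then show False using 1 WU by blast
  next
    case 2
    then have "uncrossed ends {e2} ?W" by (auto simp: uncrossed_def ends)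
    then have "uncrossed ends (N - {e0}) ?W" using unc N' uncrossed_Un uncrossed_mono by metis
    then have "a \<in> ?W \<longleftrightarrow> b \<in> ?W" using crossed_once[OF _ M N _ e02(1) ends(1)] W by blast
    then show False using 2 WU by blast
  qed
qed

text \<open>Spanning 2-regular subgraphs made of \<open>M\<close> and one matching per square. The
  connected ones turn out to be the Hamiltonian cycles containing \<open>M\<close>.\<close>

definition selection :: "'e set \<Rightarrow> bool" where
  "selection F \<longleftrightarrow> M \<subseteq> F \<and> F \<subseteq> E \<and> (\<forall>C\<in>S. F \<inter> C \<in> square_matchings ends C)"

lemma selection_matching:
  assumes "selection F"
  shows "perfect_matching V ends E (F - M)"
proof -
  have "F \<subseteq> E" using assms by (simp add: selection_def)
  then have "F - M = (\<Union>C\<in>S. F \<inter> C)" using square_sub in_square by fast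
  then show ?thesis
    using matching_from_squares[of "\<lambda>C. F \<inter> C"] assms by (simp add: selection_def)
qed

lemma selection_square_matchings:
  assumes "selection F" "C \<in> S"
  shows "square_matchings ends C = {F \<inter> C, C - F}" "F \<inter> C \<noteq> C - F"
proof -
  have "C - F \<inter> C = C - F" by blast
  then show "square_matchings ends C = {F \<inter> C, C - F}" "F \<inter> C \<noteq> C - F"
    using square_matchings_compl[OF four_cycle[OF assms(2)], of "F \<inter> C"] assms
    by (simp_all add: selection_def)
qed

lemma selection_opposite:
  assumes "selection F" "selection X" "C \<in> S" "F \<inter> C \<noteq> X \<inter> C"
  shows "X \<inter> C = C - F"
proof -
  have "X \<inter> C \<in> square_matchings ends C" using assms(2,3) by (simp add: selection_def)
  then have "X \<inter> C \<in> {F \<inter> C, C - F}" by (simp only: selection_square_matchings[OF assms(1,3)])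
  then show ?thesis using assms(4) by (metis insertE singletonD)
qed

lemma swap_Int_other:
  assumes "C \<in> S" "D \<in> S" "D \<noteq> C"
  shows "swap F C \<inter> D = F \<inter> D"
  using squares_disjoint[OF assms(1,2)] assms(3) by (auto simp: swap_def)

lemma swap_Int_self: "swap F C \<inter> C = C - F"
  by (auto simp: swap_def)

lemma selection_swap:
  assumes "selection F" "C \<in> S"
  shows "selection (swap F C)"
proof -
  have "swap F C \<inter> D \<in> square_matchings ends D" if "D \<in> S" for D
  proof (cases "D = C")
    case True
    then show ?thesis using selection_square_matchings[OF assms] by (simp add: swap_Int_self)
  next
    case False
    then show ?thesis using swap_Int_other assms that by (simp add: selection_def)
  qed
  moreover have "M \<subseteq> swap F C" "swap F C \<subseteq> E"
    using assms square_sub[OF assms(2)] by (auto simp: selection_def swap_def)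
  ultimately show ?thesis by (simp add: selection_def)
qed

lemma selection_labels:
  assumes "selection F" "C \<in> S"
  obtains a b x d e0 e1 e2 e3 where "F \<inter> C = {e0, e2}" "C - F = {e1, e3}" "a \<in> V" "b \<in> V"
    "ends e0 = {a, b}" "ends e1 = {b, x}" "ends e2 = {x, d}" "ends e3 = {d, a}"
proof -
  obtain a b x d e0 e1 e2 e3 where *: "F \<inter> C = {e0, e2}" "C - F = {e1, e3}"
    "C = {e0, e1, e2, e3}" "verts_of ends C = {a, b, x, d}" "distinct [a, b, x, d]"
    "distinct [e0, e1, e2, e3]"
    "ends e0 = {a, b}" "ends e1 = {b, x}" "ends e2 = {x, d}" "ends e3 = {d, a}"
    by (rule four_cycle_labels[OF four_cycle[OF assms(2)] selection_square_matchings(2,1)[OF assms]])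
  have "e0 \<in> E" using *(3) square_sub[OF assms(2)] by blast
  then have "a \<in> V" "b \<in> V" using ends_V *(7) by auto
  then show thesis by (rule that[OF *(1,2) _ _ *(7-10)])
qed

text \<open>
  The symmetric exchange axiom of delta-matroids. If the swap at \<open>C\<close> disconnects \<open>F\<close>, then it
  leaves exactly two components, and any square where \<open>X\<close> crosses between them can be swapped to
  join them again.
\<close>

lemma exchange:
  assumes F: "selection F" "graph_connected V ends F"
    and X: "selection X" "graph_connected V ends X"
    and C: "C \<in> S" "F \<inter> C \<noteq> X \<inter> C"
  shows "graph_connected V ends (swap F C) \<or>
    (\<exists>D\<in>S. D \<noteq> C \<and> F \<inter> D \<noteq> X \<inter> D \<and> graph_connected V ends (swap (swap F C) D))"
proof (rule disj_imp[THEN iffD2], rule impI)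
  assume nconn: "\<not> graph_connected V ends (swap F C)"
  let ?F = "swap F C"
  note G = selection_swap[OF F(1) C(1)]
  have sub: "F \<subseteq> E" "X \<subseteq> E" "?F \<subseteq> E" "M \<subseteq> ?F" "M \<subseteq> X"
    using F(1) X(1) G by (auto simp: selection_def)
  have V: "V \<noteq> {}" and trivF: "\<And>W. W \<subseteq> V \<Longrightarrow> uncrossed ends F W \<Longrightarrow> W = {} \<or> W = V"
    and trivX: "\<And>W. W \<subseteq> V \<Longrightarrow> uncrossed ends X W \<Longrightarrow> W = {} \<or> W = V"
    using F(2) X(2) connected_iff sub by blast+
  obtain a b x d e0 e1 e2 e3 where L: "F \<inter> C = {e0, e2}" "C - F = {e1, e3}" "a \<in> V" "b \<in> V"
    and ends: "ends e0 = {a, b}" "ends e1 = {b, x}" "ends e2 = {x, d}" "ends e3 = {d, a}"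
    by (rule selection_labels[OF F(1) C(1)])
  \<comment> \<open>The connected \<open>F\<close> must cross \<open>U\<close>, and its only edges
    missing from \<open>?F\<close> are \<open>e0\<close> and \<open>e2\<close>. Since
    \<open>e1\<close> and \<open>e3\<close> do not cross \<open>U\<close>, either both of these
    cross or neither does.\<close>
  have cross: "a \<in> U \<longleftrightarrow> b \<notin> U" if U: "U \<subseteq> V" "uncrossed ends ?F U" "U \<noteq> {}" "U \<noteq> V" for U
  proof (rule ccontr)
    assume "\<not> ?thesis"
    moreover have "uncrossed ends {e1, e3} U"
      by (rule uncrossed_mono[OF U(2)]) (use L in \<open>auto simp: swap_def\<close>)
    ultimately have "uncrossed ends {e0, e2} U" by (auto simp: uncrossed_def ends)
    then have "uncrossed ends (?F \<union> {e0, e2}) U" using U(2) unfolding uncrossed_Un by blast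
    then have "uncrossed ends F U"
      by (rule uncrossed_mono) (use L(1) in \<open>auto simp: swap_def\<close>)
    then show False using trivF U by blast
  qed
  obtain W where W: "W \<subseteq> V" "uncrossed ends ?F W" "W \<noteq> {}" "W \<noteq> V"
    using nconn V connected_iff[OF sub(3)] by blast
  have W': "V - W \<subseteq> V" "uncrossed ends ?F (V - W)" "V - W \<noteq> {}" "V - W \<noteq> V"
    using W uncrossed_compl[OF W(2)] ends_V sub(3) by blast+
  \<comment> \<open>The symmetric difference is uncrossed and avoids both \<open>a\<close> and
    \<open>b\<close>, so by \<open>cross\<close> it is trivial. Hence \<open>W\<close> and
    \<open>V - W\<close> are the only nontrivial uncrossed sets.\<close>
  have eq: "U = U'" if U: "U \<subseteq> V" "uncrossed ends ?F U" "U \<noteq> {}" "U \<noteq> V"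
    and U': "U' \<subseteq> V" "uncrossed ends ?F U'" "U' \<noteq> {}" "U' \<noteq> V" and a: "a \<in> U \<longleftrightarrow> a \<in> U'" for U U'
  proof -
    let ?D = "(U - U') \<union> (U' - U)"
    have "a \<notin> ?D" "b \<notin> ?D" using a cross[OF U] cross[OF U'] by blast+
    moreover have "?D \<subseteq> V" using U U' by blast
    ultimately have "?D = {} \<or> ?D = V"
      using cross[OF _ uncrossed_sym_diff[OF U(2) U'(2)]] by blast
    then show ?thesis using \<open>a \<notin> ?D\<close> L(3) by blast
  qed
  have two: "U = W \<or> U = V - W" if U: "U \<subseteq> V" "uncrossed ends ?F U" "U \<noteq> {}" "U \<noteq> V" for U
    using eq[OF U W] eq[OF U W'] L(3) by blast
  \<comment> \<open>The connected competitor \<open>X\<close> supplies an edge \<open>f\<close>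
    between the two components. It lies in a square other than \<open>C\<close>, because on
    \<open>C\<close> the sets \<open>X\<close> and \<open>?F\<close> agree.\<close>
  have "\<not> uncrossed ends X W" using trivX W by blast
  then obtain f where f: "f \<in> X" "\<not> (ends f \<subseteq> W \<or> ends f \<inter> W = {})"
    unfolding uncrossed_def by blast
  then have f': "f \<notin> ?F" using W(2) unfolding uncrossed_def by blast
  then obtain D where D: "D \<in> S" "f \<in> D" using in_square f(1) sub by blast
  have XC: "X \<inter> C = C - F" by (rule selection_opposite[OF F(1) X(1) C])
  have DC: "D \<noteq> C" using XC f(1) f' D(2) by (auto simp: swap_def)
  have FD: "?F \<inter> D = F \<inter> D" by (rule swap_Int_other[OF C(1) D(1) DC])
  then have FX: "F \<inter> D \<noteq> X \<inter> D" using f(1) f' D(2) by blast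
  obtain p q r s g0 g1 g2 g3 where K: "?F \<inter> D = {g0, g2}" "D - ?F = {g1, g3}" "p \<in> V" "q \<in> V"
    and ends': "ends g0 = {p, q}" "ends g1 = {q, r}" "ends g2 = {r, s}" "ends g3 = {s, p}"
    by (rule selection_labels[OF G D(1)])
  have "uncrossed ends {g0, g2} W"
    by (rule uncrossed_mono[OF W(2)]) (use K in auto)
  moreover have "f = g1 \<or> f = g3" using K(2) f' D(2) by blast
  \<comment> \<open>The edges \<open>g0\<close> and \<open>g2\<close> of \<open>?F\<close> lie on
    different sides of \<open>W\<close>, since \<open>f\<close> joins them.\<close>
  ultimately have pqrs: "p \<in> W \<longleftrightarrow> q \<in> W" "r \<in> W \<longleftrightarrow> s \<in> W" "q \<in> W \<longleftrightarrow> r \<notin> W"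
    using f(2) by (auto simp: uncrossed_def ends')
  let ?G = "swap ?F D"
  have G_sub: "?G \<subseteq> E" using selection_swap[OF G D(1)] by (simp add: selection_def)
  have "graph_connected V ends ?G"
    unfolding connected_iff[OF G_sub]
  proof (intro conjI V allI impI)
    fix U assume U: "U \<subseteq> V" "uncrossed ends ?G U"
    show "U = {} \<or> U = V"
    proof (rule ccontr)
      assume nontriv: "\<not> (U = {} \<or> U = V)"
      have "uncrossed ends {g1, g3} U"
        by (rule uncrossed_mono[OF U(2)]) (use K in \<open>auto simp: swap_def\<close>)
      then have qr: "q \<in> U \<longleftrightarrow> r \<in> U" "s \<in> U \<longleftrightarrow> p \<in> U" by (auto simp: uncrossed_def ends')
      have rest: "uncrossed ends (?F - D) U"
        by (rule uncrossed_mono[OF U(2)]) (auto simp: swap_def)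
      have F_eq: "?F = (?F - D) \<union> {g0, g2}" using K(1) by blast
      \<comment> \<open>Otherwise \<open>?F\<close> would not cross \<open>U\<close>, making
        \<open>U\<close> one of the two components; but \<open>q\<close> and \<open>r\<close> are on
        the same side of \<open>U\<close> and on different sides of \<open>W\<close>.\<close>
      have pq: "p \<in> U \<longleftrightarrow> q \<notin> U"
      proof (rule ccontr)
        assume "\<not> ?thesis"
        then have "uncrossed ends {g0, g2} U" using qr by (auto simp: uncrossed_def ends')
        then have "uncrossed ends ?F U" using rest F_eq uncrossed_Un by metis
        then have "U = W \<or> U = V - W" using two U(1) nontriv by blast
        moreover have "r \<in> V" using ends_V[of g1] K(2) square_sub[OF D(1)] ends'(2) by auto
        ultimately show False using qr pqrs K(4) by blast
      qed
      \<comment> \<open>This set contains exactly one vertex of \<open>D\<close>, so the perfect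
        matching \<open>?F - M\<close> crosses it exactly once, against parity. The case split finds
        whether \<open>g0\<close> or \<open>g2\<close> crosses.\<close>
      let ?T = "U \<inter> W"
      have T: "?T \<subseteq> V" using W(1) by blast
      have restT: "uncrossed ends (?F - D) ?T"
        by (rule uncrossed_Int[OF rest uncrossed_mono[OF W(2)]]) blast
      have MT: "uncrossed ends M ?T"
        by (rule uncrossed_mono[OF restT]) (use sub(4) square_sub[OF D(1)] in blast)
      note N = selection_matching[OF G]
      have g: "g0 \<in> ?F - M" "g2 \<in> ?F - M" using K(1) square_sub[OF D(1)] by blast+
      show False
      proof (cases "p \<in> W")
        case True
        then have "uncrossed ends {g2} ?T" using pqrs by (auto simp: uncrossed_def ends')
        then have "uncrossed ends ((?F - D) \<union> {g2}) ?T" using restT unfolding uncrossed_Un by blast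
        then have "uncrossed ends (?F - M - {g0}) ?T"
          by (rule uncrossed_mono) (use F_eq in blast)
        from crossed_once[OF T MT N this g(1) ends'(1)] show False using True pqrs pq by blast
      next
        case False
        then have "uncrossed ends {g0} ?T" using pqrs by (auto simp: uncrossed_def ends')
        then have "uncrossed ends ((?F - D) \<union> {g0}) ?T" using restT unfolding uncrossed_Un by blast
        then have "uncrossed ends (?F - M - {g2}) ?T"
          by (rule uncrossed_mono) (use F_eq in blast)
        from crossed_once[OF T MT N this g(2) ends'(3)] show False using False pqrs pq qr by blast
      qed
    qed
  qed
  then show "\<exists>D\<in>S. D \<noteq> C \<and> F \<inter> D \<noteq> X \<inter> D \<and> graph_connected V ends (swap ?F D)"
    using D(1) DC FX by blast
qed

section \<open>Connected selections and Hamiltonian cycles containing \<open>M\<close>\<close>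

lemma selection_incident:
  assumes "selection F" "v \<in> V"
  shows "card {e \<in> F. v \<in> ends e} = 2"
proof -
  obtain m where m: "m \<in> M" "v \<in> ends m" "\<And>e. e \<in> M \<Longrightarrow> v \<in> ends e \<Longrightarrow> e = m"
    using matching_M assms(2) unfolding perfect_matching_def by blast
  obtain k where k: "k \<in> F - M" "v \<in> ends k" "\<And>e. e \<in> F - M \<Longrightarrow> v \<in> ends e \<Longrightarrow> e = k"
    using selection_matching[OF assms(1)] assms(2) unfolding perfect_matching_def by blast
  have "{e \<in> F. v \<in> ends e} = {m, k}" using m k assms(1) unfolding selection_def by blast
  moreover have "m \<noteq> k" using m k by blast
  ultimately show ?thesis by simp
qed

lemma hamiltonian_if_selection:
  assumes "selection F" "graph_connected V ends F"
  shows "hamiltonian_cycle V E ends F"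
proof -
  have "F \<subseteq> E" using assms(1) by (simp add: selection_def)
  then have "cycle_on V ends F"
    using ends_V card_ends selection_incident assms finite_V
    by (intro cycle_if_connected_2_regular) auto
  then show ?thesis using \<open>F \<subseteq> E\<close> by (simp add: hamiltonian_cycle_def)
qed

text \<open>Of the two cycle edges at a vertex of a square, one is the edge of \<open>M\<close>; the
  other lies in a square through that vertex, which can only be the given one.\<close>

lemma selection_if_hamiltonian:
  assumes "hamiltonian_cycle V E ends F" "M \<subseteq> F"
  shows "selection F" "graph_connected V ends F"
proof -
  have F: "F \<subseteq> E" "cycle_on V ends F" using assms(1) by (auto simp: hamiltonian_cycle_def)
  show "graph_connected V ends F"
    by (rule cycle_on_connected[OF F(2)]) (use F(1) ends_V card_ends in blast)
  have "perfect_matching (verts_of ends C) ends C (F \<inter> C)" if C: "C \<in> S" for C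
    unfolding perfect_matching_def
  proof (intro conjI ballI)
    fix v assume v: "v \<in> verts_of ends C"
    then have vV: "v \<in> V" using square_sub[OF C] ends_V unfolding verts_of_def by blast
    obtain f g where fg: "f \<noteq> g" "{e \<in> F. v \<in> ends e} = {f, g}"
      by (rule cycle_on_incident[OF F(2) vV])
    obtain m where m: "m \<in> M" "v \<in> ends m" "\<And>e. e \<in> M \<Longrightarrow> v \<in> ends e \<Longrightarrow> e = m"
      using matching_M vV unfolding perfect_matching_def by blast
    have "m \<in> {f, g}" using m assms(2) fg(2) by blast
    then obtain k where k: "{e \<in> F. v \<in> ends e} = {m, k}" "k \<noteq> m"
      using fg by (metis doubleton_eq_iff empty_iff insert_iff)
    have kF: "k \<in> F" "v \<in> ends k" using k(1) by blast+
    have "k \<notin> M" using m k kF by blast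
    then obtain D where D: "D \<in> S" "k \<in> D" using in_square kF F(1) by blast
    have "D = C" by (rule verts_disjoint[OF D(1) C _ v]) (use D kF in \<open>auto simp: verts_of_def\<close>)
    show "\<exists>!e. e \<in> F \<inter> C \<and> v \<in> ends e"
    proof (rule ex1I[of _ k])
      show "k \<in> F \<inter> C \<and> v \<in> ends k" using kF D \<open>D = C\<close> by blast
      fix e assume e: "e \<in> F \<inter> C \<and> v \<in> ends e"
      then have "e \<in> {m, k}" using k(1) by blast
      moreover have "e \<noteq> m" using e m(1) square_sub[OF C] by blast
      ultimately show "e = k" by blast
    qed
  qed blast
  then show "selection F" using F assms(2) by (simp add: selection_def square_matchings_def)
qed

section \<open>Costs of swaps and single steps of HAM\<close>

lemma cost_swap:
  assumes "selection F" "C \<in> S"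
  shows "cost c (swap F C) = cost c F - cost c (F \<inter> C) + cost c (C - F)"
proof -
  have fin: "finite F" "finite C"
    using assms square_sub[OF assms(2)] finite_E by (auto simp: selection_def intro: finite_subset)
  have "cost c (swap F C) = cost c (F - C) + cost c (C - F)"
    unfolding cost_def swap_def by (rule sum.union_disjoint) (use fin in auto)
  moreover have "cost c F = cost c (F - C) + cost c (F \<inter> C)"
    unfolding cost_def using sum.Int_Diff[OF fin(1), of c C] by simp
  ultimately show ?thesis by simp
qed

lemma cost_swap_le:
  assumes "selection F" "C \<in> S"
  shows "cost c (swap F C) \<le> cost c F + square_weight ends c C"
  using cost_swap[OF assms] square_weight_eq[OF selection_square_matchings(2,1)[OF assms], of c]
  by simp

text \<open>The last premise excludes the case in which \<open>ham_step\<close> prescribes nothing.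
  The comparison of costs is available as soon as deleting the kept matching \<open>P\<close> would
  have been possible as well.\<close>

lemma ham_step_connected:
  assumes "ham_step V ends c C H H'" and "C \<in> S"
    and "\<exists>P\<in>square_matchings ends C. graph_connected V ends (H - P)"
  obtains P Q where "P \<noteq> Q" "square_matchings ends C = {P, Q}" "P = C - Q" "H' = H - Q" "Q \<subseteq> C"
    "graph_connected V ends (H - Q)" "graph_connected V ends (H - P) \<Longrightarrow> cost c P \<le> cost c Q"
proof -
  obtain P Q where PQ: "P \<noteq> Q" "square_matchings ends C = {P, Q}" "H' = H - Q"
    "graph_connected V ends (H - P) \<and> graph_connected V ends (H - Q) \<longrightarrow> cost c P \<le> cost c Q"
    "graph_connected V ends (H - P) \<noteq> graph_connected V ends (H - Q) \<longrightarrow>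
       graph_connected V ends (H - Q)"
    using assms(1) unfolding ham_step_def by blast
  have Q: "Q \<in> square_matchings ends C" using PQ(2) by simp
  have QC: "P = C - Q" "Q \<subseteq> C"
    using square_matchings_compl[OF four_cycle[OF assms(2)] Q] PQ(1,2) by (auto simp: doubleton_eq_iff)
  have conn: "graph_connected V ends (H - Q)" using assms(3) PQ(2,5) by auto
  show thesis by (rule that[OF PQ(1,2) QC(1) PQ(3) QC(2) conn]) (use PQ(4) conn in blast)
qed

end

section \<open>Optimality of the greedy procedure\<close>

locale ham = squares V E M ends "set Cs"
  for V :: "'v set" and E M :: "'e set" and ends :: "'e \<Rightarrow> 'v set" and Cs :: "'e set list" +
  fixes c :: "'e \<Rightarrow> real" and H :: "nat \<Rightarrow> 'e set"
  assumes distinct_Cs: "distinct Cs" and connected_E: "graph_connected V ends E"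
    and sorted: "sorted_wrt (\<lambda>C D. square_weight ends c C \<ge> square_weight ends c D) Cs"
    and run: "ham_run V E ends c Cs H"
begin

lemma H_0: "H 0 = E"
  using run by (simp add: ham_run_def)

lemma H_step: "i < length Cs \<Longrightarrow> ham_step V ends c (Cs ! i) (H i) (H (Suc i))"
  using run by (simp add: ham_run_def)

lemma Cs_disjoint: "i < length Cs \<Longrightarrow> j < length Cs \<Longrightarrow> i \<noteq> j \<Longrightarrow> Cs ! i \<inter> Cs ! j = {}"
  using squares_disjoint distinct_Cs by (simp add: nth_eq_iff_index_eq)

text \<open>The invariant of the run: processed squares have one matching left, the others are
  intact. It provides the hypotheses of \<open>some_choice_connected\<close> for the next
  square.\<close>

definition partial :: "nat \<Rightarrow> bool" where
  "partial i \<longleftrightarrow> M \<subseteq> H i \<and> H i \<subseteq> E \<and> graph_connected V ends (H i) \<and>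
     (\<forall>j<i. H i \<inter> Cs ! j \<in> square_matchings ends (Cs ! j)) \<and>
     (\<forall>j<length Cs. i \<le> j \<longrightarrow> Cs ! j \<subseteq> H i)"

lemma partial_choice:
  assumes "partial i" "i < length Cs"
  shows "\<exists>P\<in>square_matchings ends (Cs ! i). graph_connected V ends (H i - P)"
proof (rule some_choice_connected)
  fix D assume "D \<in> set Cs"
  then obtain j where j: "j < length Cs" "D = Cs ! j" by (metis in_set_conv_nth)
  show "\<exists>P\<in>square_matchings ends D. P \<subseteq> H i"
  proof (cases "j < i")
    case True
    then show ?thesis using assms(1) j by (auto simp: partial_def intro!: bexI[of _ "H i \<inter> D"])
  next
    case False
    then have "D \<subseteq> H i" using assms(1) j by (simp add: partial_def)
    then show ?thesis
      using four_cycle_matchings[OF four_cycle[OF \<open>D \<in> set Cs\<close>]] by (metis Un_subset_iff insertI1)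
  qed
qed (use assms in \<open>auto simp: partial_def\<close>)

lemma H_step_choice:
  assumes "partial i" "i < length Cs"
  obtains P Q where "P \<noteq> Q" "square_matchings ends (Cs ! i) = {P, Q}" "P = Cs ! i - Q"
    "H (Suc i) = H i - Q" "Q \<subseteq> Cs ! i" "graph_connected V ends (H i - Q)"
    "graph_connected V ends (H i - P) \<Longrightarrow> cost c P \<le> cost c Q"
  by (rule ham_step_connected[OF H_step[OF assms(2)] nth_mem[OF assms(2)] partial_choice[OF assms]])
    (rule that)

lemma partial: "i \<le> length Cs \<Longrightarrow> partial i"
proof (induction i)
  case 0
  have "Cs ! j \<subseteq> E" if "j < length Cs" for j using square_sub[OF nth_mem[OF that]] by blast
  then show ?case using M_sub connected_E by (simp add: partial_def H_0)
next
  case (Suc i)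
  then have IH: "partial i" and i: "i < length Cs" by auto
  obtain P Q where PQ: "square_matchings ends (Cs ! i) = {P, Q}" "P = Cs ! i - Q"
    "H (Suc i) = H i - Q" "Q \<subseteq> Cs ! i" "graph_connected V ends (H i - Q)"
    using H_step_choice[OF IH i] by metis
  have "M \<subseteq> H (Suc i)"
    using IH PQ(3,4) square_sub[OF nth_mem[OF i]] by (auto simp: partial_def)
  moreover have other: "H (Suc i) \<inter> Cs ! j = H i \<inter> Cs ! j" if "j < length Cs" "j \<noteq> i" for j
    using Cs_disjoint[OF that(1) i that(2)] PQ(3,4) by blast
  moreover have "H (Suc i) \<inter> Cs ! j \<in> square_matchings ends (Cs ! j)" if "j < Suc i" for j
  proof (cases "j = i")
    case True
    have "H (Suc i) \<inter> Cs ! i = P" using PQ(2,3) IH i unfolding partial_def by blast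
    then show ?thesis using True PQ(1) by simp
  next
    case False
    then show ?thesis using other[of j] IH that i by (simp add: partial_def)
  qed
  moreover have "Cs ! j \<subseteq> H (Suc i)" if "j < length Cs" "Suc i \<le> j" for j
  proof -
    have "Cs ! j \<subseteq> H i" using IH that by (simp add: partial_def)
    moreover have "H (Suc i) \<inter> Cs ! j = H i \<inter> Cs ! j" using other that by simp
    ultimately show ?thesis by blast
  qed
  ultimately show ?case using IH PQ(3,5) by (auto simp: partial_def)
qed

text \<open>Later steps delete edges of other squares only, so the choice made at a square is
  final.\<close>

lemma H_stable:
  assumes "j < k" "k \<le> length Cs"
  shows "H (length Cs) \<inter> Cs ! j = H k \<inter> Cs ! j"
  using assms(2,1)
proof (induction rule: inc_induct)
  case (step n)
  obtain Q where "H (Suc n) = H n - Q" "Q \<subseteq> Cs ! n"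
    using H_step_choice[OF partial] step.hyps by (metis less_imp_le)
  then show ?case using step Cs_disjoint[of j n] by fastforce
qed simp

lemma selection_result: "selection (H (length Cs))"
  using partial[OF order_refl] by (auto simp: partial_def selection_def in_set_conv_nth)

text \<open>Induction downwards on the length of the initial segment on which \<open>F\<close>
  agrees with the result: a disagreement at square \<open>n\<close> is repaired by an exchange that
  does not raise the cost and keeps the earlier agreement.\<close>

lemma greedy_optimal:
  assumes "k \<le> length Cs" "selection F" "graph_connected V ends F"
    and "\<And>j. j < k \<Longrightarrow> F \<inter> Cs ! j = H (length Cs) \<inter> Cs ! j"
  shows "cost c (H (length Cs)) \<le> cost c F"
  using assms
proof (induction arbitrary: F rule: inc_induct)
  case base
  have sel: "M \<subseteq> G \<and> G \<subseteq> E" if "selection G" for G using that by (simp add: selection_def)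
  have "e \<in> F \<longleftrightarrow> e \<in> H (length Cs)" for e
  proof (cases "e \<in> E - M")
    case True
    then obtain j where "j < length Cs" "e \<in> Cs ! j" using in_square by (metis DiffE in_set_conv_nth)
    then show ?thesis using base(3)[of j] by blast
  next
    case False
    then show ?thesis using sel[OF base(1)] sel[OF selection_result] by blast
  qed
  then have "F = H (length Cs)" by blast
  then show ?case by simp
next
  case (step n)
  let ?X = "H (length Cs)" and ?C = "Cs ! n"
  have n: "n < length Cs" and C: "?C \<in> set Cs" using step.hyps by auto
  have part: "partial n" using partial n by simp
  have X: "selection ?X" "graph_connected V ends ?X"
    using selection_result partial[OF order_refl] by (auto simp: partial_def)
  note F = step.prems
  show ?case
  proof (cases "F \<inter> ?C = ?X \<inter> ?C")
    case True
    then show ?thesis using step.IH F by (metis less_SucE)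
  next
    case False
    obtain P Q where PQ: "P \<noteq> Q" "square_matchings ends ?C = {P, Q}" "P = ?C - Q"
      "H (Suc n) = H n - Q" "Q \<subseteq> ?C"
      and le: "graph_connected V ends (H n - P) \<Longrightarrow> cost c P \<le> cost c Q"
      using H_step_choice[OF part n] by metis
    have "?C \<subseteq> H n" using part n by (simp add: partial_def)
    then have "?X \<inter> ?C = P" using H_stable[of n "Suc n"] n PQ(3,4) by auto
    then have FQ: "?C - F = P" "F \<inter> ?C = Q"
      using selection_opposite[OF F(1) X(1) C False] PQ(3,5) by blast+
    \<comment> \<open>On squares before \<open>n\<close> the set \<open>F\<close> agrees with
      choices already made, and \<open>H n\<close> contains all later squares. As \<open>F\<close>
      also avoids \<open>P\<close>, deleting \<open>P\<close> at step \<open>n\<close> would have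
      kept the graph connected, so HAM decided by cost.\<close>
    have "F \<subseteq> H n"
    proof
      fix e assume e: "e \<in> F"
      show "e \<in> H n"
      proof (cases "e \<in> M")
        case True
        then show ?thesis using part by (auto simp: partial_def)
      next
        case False
        then have "e \<in> E - M" using e F(1) by (auto simp: selection_def)
        then obtain j where j: "j < length Cs" "e \<in> Cs ! j"
          using in_square by (metis DiffE in_set_conv_nth)
        show ?thesis
        proof (cases "j < n")
          case True
          then show ?thesis using F(3)[of j] H_stable[of j n] n e j by auto
        next
          case False
          then show ?thesis using part j by (auto simp: partial_def)
        qed
      qed
    qed
    then have "F \<subseteq> H n - P" using FQ(1) by blast
    then have "cost c P \<le> cost c Q" using le graph_connected_mono[OF F(2)] by blast
    \<comment> \<open>The swap replaces \<open>Q\<close> by the cheaper or equal \<open>P\<close>,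
      so it gains exactly the weight of the square.\<close>
    then have w: "cost c (swap F ?C) = cost c F - square_weight ends c ?C"
      using cost_swap[OF F(1) C, of c] square_weight_eq[OF PQ(1,2), of c] FQ by simp
    have w0: "square_weight ends c ?C \<ge> 0" using square_weight_eq[OF PQ(1,2), of c] by simp
    have agree: "swap F ?C \<inter> Cs ! j = ?X \<inter> Cs ! j" if "j < Suc n" for j
    proof (cases "j = n")
      case True
      then show ?thesis using FQ \<open>?X \<inter> ?C = P\<close> by (simp add: swap_Int_self)
    next
      case False
      then have "Cs ! j \<in> set Cs" "Cs ! j \<noteq> ?C"
        using that n distinct_Cs by (auto simp: nth_eq_iff_index_eq)
      then show ?thesis using swap_Int_other[OF C] F(3)[of j] False that by simp
    qed
    note sel = selection_swap[OF F(1) C]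
    consider "graph_connected V ends (swap F ?C)"
      | D where "D \<in> set Cs" "D \<noteq> ?C" "F \<inter> D \<noteq> ?X \<inter> D"
        "graph_connected V ends (swap (swap F ?C) D)"
      using exchange[OF F(1,2) X C False] by blast
    then show ?thesis
    proof cases
      case 1
      then have "cost c ?X \<le> cost c (swap F ?C)" using step.IH sel agree by blast
      then show ?thesis using w w0 by simp
    next
      case 2
      then obtain m where m: "m < length Cs" "D = Cs ! m" by (metis in_set_conv_nth)
      \<comment> \<open>The second square shows a disagreement and differs from \<open>?C\<close>,
        so it comes after \<open>n\<close>; by the order its weight is at most the gain in
        \<open>w\<close>.\<close>
      have "\<not> m < n" using 2(3) F(3) m(2) by blast
      moreover have "m \<noteq> n" using 2(2) m(2) by blast
      ultimately have nm: "n < m" by simp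
      have agree': "swap (swap F ?C) D \<inter> Cs ! j = ?X \<inter> Cs ! j" if "j < Suc n" for j
      proof -
        have "Cs ! j \<in> set Cs" "Cs ! j \<noteq> D"
          using that n nm m distinct_Cs by (auto simp: nth_eq_iff_index_eq)
        then show ?thesis using swap_Int_other[OF 2(1)] agree[OF that] by simp
      qed
      have "cost c ?X \<le> cost c (swap (swap F ?C) D)"
        using step.IH[OF selection_swap[OF sel 2(1)] 2(4)] agree' by blast
      also have "\<dots> \<le> cost c (swap F ?C) + square_weight ends c D"
        by (rule cost_swap_le[OF sel 2(1)])
      also have "\<dots> \<le> cost c F"
        using w sorted_wrt_nth_less[OF sorted nm m(1)] m(2) by simp
      finally show ?thesis .
    qed
  qed
qed

end

theorem theorem12:
  fixes V :: "'v set" and E M :: "'e set" and ends :: "'e \<Rightarrow> 'v set"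
    and c :: "'e \<Rightarrow> real" and Cs :: "'e set list" and H :: "nat \<Rightarrow> 'e set"
  assumes "square_graph V E ends M"
    and "distinct Cs" and "square_decomposition ends (E - M) (set Cs)"
    and "sorted_wrt (\<lambda>C D. square_weight ends c C \<ge> square_weight ends c D) Cs"
    and "ham_run V E ends c Cs H"
  shows "(\<forall>i < length Cs. \<exists>P \<in> square_matchings ends (Cs ! i).
            graph_connected V ends (H i - P)) \<and>
         hamiltonian_cycle V E ends (H (length Cs)) \<and> M \<subseteq> H (length Cs) \<and>
         (\<forall>F. hamiltonian_cycle V E ends F \<and> M \<subseteq> F \<longrightarrow> cost c (H (length Cs)) \<le> cost c F)"
proof -
  have G: "finite V" "finite E" "\<And>e. e \<in> E \<Longrightarrow> ends e \<subseteq> V" "\<And>e. e \<in> E \<Longrightarrow> card (ends e) = 2"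
    "cubic V ends E" "graph_connected V ends E" "perfect_matching V ends E M"
    using assms(1) by (auto simp: square_graph_def finite_graph_def two_edge_connected_def)
  have "\<exists>C\<in>set Cs. v \<in> verts_of ends C" if v: "v \<in> V" for v
  proof -
    obtain m where m: "m \<in> M" "v \<in> ends m" "\<And>e. e \<in> M \<Longrightarrow> v \<in> ends e \<Longrightarrow> e = m"
      using G(7) v unfolding perfect_matching_def by blast
    have "card {e \<in> E. v \<in> ends e} = 3" using G(5) v by (simp add: cubic_def)
    \<comment> \<open>Three edges meet \<open>v\<close> and only \<open>m\<close> among them is in
      \<open>M\<close>, so another one lies in a square.\<close>
    then have "\<not> {e \<in> E. v \<in> ends e} \<subseteq> {m}"
      using card_mono[of "{m}" "{e \<in> E. v \<in> ends e}"] by force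
    then obtain e where e: "e \<in> E" "v \<in> ends e" "e \<notin> M" using m(3) by blast
    then have "e \<in> \<Union>(set Cs)" using assms(3) by (simp add: square_decomposition_def)
    then show ?thesis using e unfolding verts_of_def by blast
  qed
  then interpret ham V E M ends Cs c H
    using G assms by unfold_locales auto
  have "cost c (H (length Cs)) \<le> cost c F" if "hamiltonian_cycle V E ends F" "M \<subseteq> F" for F
    \<comment> \<open>With the empty initial segment no agreement is demanded of
      \<open>F\<close>.\<close>
    by (rule greedy_optimal[of 0]) (use selection_if_hamiltonian[OF that] in auto)
  moreover have "hamiltonian_cycle V E ends (H (length Cs))"
    using hamiltonian_if_selection[OF selection_result] partial[OF order_refl]
    by (simp add: partial_def)
  moreover have "M \<subseteq> H (length Cs)" using selection_result by (simp add: selection_def)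
  moreover have "\<forall>i<length Cs. \<exists>P\<in>square_matchings ends (Cs ! i). graph_connected V ends (H i - P)"
    using partial_choice partial by simp
  ultimately show ?thesis by blast
qed

end
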